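(* Let $X$ be a Banach space, $(\Omega,\mathcal{A},P)$ a probability space, and let $(B_t)_t$ be a set-valued Brownian motion taking values in an $f$-algebra $L\subset C(K)$, with natural filtration $(\mathcal{F}_s)_s$. Then for all real numbers $0<s<t$, $$\mathbb{E}(B_t^2\mid\mathcal{F}_s)=B_s^2+(t-s)e .$$
   Context: For a Banach space $X$, $ck(X)$ is the family of nonempty compact convex subsets of $X$, with Minkowski addition, multiplication by scalars and the Hausdorff metric $d_H$. $K$ is a compact Hausdorff space and $j:ck(X)\to C(K)$ is a map (such $K,j$ exist) satisfying: (a) $j(\alpha A+\beta C)=\alpha j(A)+\beta j(C)$ for all $A,C\in ck(X)$, $\alpha,\beta\ge 0$; (b) $d_H(A,C)=\|j(A)-j(C)\|_\infty$; (c) $j(ck(X))$ is norm closed; (d) $j(\mathrm{co}(A\cup C))=\max\{j(A),j(C)\}$. Sums, differences and products are taken in $C(K)$ via $j$. $e$ is the unit function (constant $1$) of $C(K)$. $ck_r(X)$ denotes the collection of functions $r1_B$ with $r\in\mathbb{R}$, $B\in ck(X)$; $r1_B$ is identified with $r\,j(B)\in C(K)$. An evaluation functional is an $f\in C(K)^*$ of the form $f(x)=x(k)$ for some fixed $k\in K$. A process $(B_t)_t$ with values in $ck_r(X)\subset C(K)$ is a set-valued Brownian motion if: (1) there is an $f$-algebra $L$ such that $B_t(\omega)\in L$ for each $\omega\in\Omega$ and $t>0$; (2) $B_t$ and $B_t^2$ are $C(K)$-valued Bochner integrable functions for each $t>0$; (3) for every evaluation functional $f\in C(K)^*$ the process $(f(B_t))_t$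 is a standard real Brownian motion. For a Bochner integrable $W$ and a sub-$\sigma$-algebra $\mathcal{F}\subset\mathcal{A}$, $\mathbb{E}(W\mid\mathcal{F})$ is the Bochner integrable function with respect to $(\Omega,\mathcal{F},P)$ such that $\mathbb{E}(f(W)\mid\mathcal{F})=f(\mathbb{E}(W\mid\mathcal{F}))$ for every $f\in C(K)^*$.
   Formalization: Condition (3) is strengthened: each f(B_t) is a standard Brownian motion relative to the natural filtration (F_s) of the whole process, so f(B_t)-f(B_s) is independent of F_s; with each f(B_t) Brownian only in its own filtration the claim fails. *)

theory Defs
  imports "HOL-Probability.Probability"
begin

section \<open>Algebra and order on bounded continuous functions\<close>

text \<open>
  The space \<open>C(K)\<close> is rendered as \<open>'k \<Rightarrow>\<^sub>C real\<close> with \<open>compact (UNIV :: 'k set)\<close> and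
  \<open>'k\<close> of class \<open>t2_space\<close>; the library norm on this type is the supremum norm. Only the
  pointwise product, the unit function and the pointwise order are missing in the library.
\<close>

lemma times_bcontfun_aux:
  fixes f g :: "'a::topological_space \<Rightarrow>\<^sub>C 'b::real_normed_algebra"
  shows "(\<lambda>x. f x * g x) \<in> bcontfun"
proof (rule bcontfun_normI)
  show "continuous_on UNIV (\<lambda>x. f x * g x)"
    by (intro continuous_intros continuous_on_apply_bcontfun)
  show "norm (f x * g x) \<le> norm f * norm g" for x
    by (rule order_trans[OF norm_mult_ineq mult_mono]) (auto intro: norm_bounded)
qed

instantiation bcontfun :: (topological_space, real_normed_algebra) real_normed_algebra
begin

definition times_bcontfun :: "('a \<Rightarrow>\<^sub>C 'b) \<Rightarrow> ('a \<Rightarrow>\<^sub>C 'b) \<Rightarrow> 'a \<Rightarrow>\<^sub>C 'b"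
  where "times_bcontfun f g = Bcontfun (\<lambda>x. f x * g x)"

lemma apply_bcontfun_times [simp]:
  "apply_bcontfun (f * g) x = apply_bcontfun f x * apply_bcontfun g x"
  for f g :: "'a \<Rightarrow>\<^sub>C 'b"
  by (simp add: times_bcontfun_def Bcontfun_inverse times_bcontfun_aux)

instance
proof
  fix f g :: "'a \<Rightarrow>\<^sub>C 'b"
  show "norm (f * g) \<le> norm f * norm g"
  proof (rule norm_bound)
    show "norm (apply_bcontfun (f * g) x) \<le> norm f * norm g" for x
      unfolding apply_bcontfun_times
      by (rule order_trans[OF norm_mult_ineq mult_mono]) (auto intro: norm_bounded)
  qed
qed (auto intro!: bcontfun_eqI simp: algebra_simps)

end

instantiation bcontfun :: (topological_space, real_normed_algebra_1) real_normed_algebra_1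
begin

definition one_bcontfun :: "'a \<Rightarrow>\<^sub>C 'b"
  where "one_bcontfun = const_bcontfun 1"

lemma apply_bcontfun_one [simp]: "apply_bcontfun (1 :: 'a \<Rightarrow>\<^sub>C 'b) x = 1"
  by (simp add: one_bcontfun_def)

instance
proof
  show "norm (1 :: 'a \<Rightarrow>\<^sub>C 'b) = 1"
  proof (rule antisym)
    show "norm (1 :: 'a \<Rightarrow>\<^sub>C 'b) \<le> 1"
      by (rule norm_bound) simp
    show "1 \<le> norm (1 :: 'a \<Rightarrow>\<^sub>C 'b)"
      using norm_bounded[of "1 :: 'a \<Rightarrow>\<^sub>C 'b" undefined] by simp
  qed
  show "(0 :: 'a \<Rightarrow>\<^sub>C 'b) \<noteq> 1"
  proof
    assume "(0 :: 'a \<Rightarrow>\<^sub>C 'b) = 1"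
    then have "apply_bcontfun (0 :: 'a \<Rightarrow>\<^sub>C 'b) undefined = apply_bcontfun 1 undefined"
      by simp
    then show False by simp
  qed
qed (auto intro!: bcontfun_eqI)

end

instantiation bcontfun :: (topological_space, "{metric_space, order}") order
begin

definition less_eq_bcontfun :: "('a \<Rightarrow>\<^sub>C 'b) \<Rightarrow> ('a \<Rightarrow>\<^sub>C 'b) \<Rightarrow> bool"
  where "less_eq_bcontfun f g \<longleftrightarrow> (\<forall>x. f x \<le> g x)"

definition less_bcontfun :: "('a \<Rightarrow>\<^sub>C 'b) \<Rightarrow> ('a \<Rightarrow>\<^sub>C 'b) \<Rightarrow> bool"
  where "less_bcontfun f g \<longleftrightarrow> f \<le> g \<and> \<not> g \<le> f"

instance
  by standard
    (auto simp: less_eq_bcontfun_def less_bcontfun_def intro: order_trans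
      intro!: bcontfun_eqI order.antisym)

end

section \<open>f-algebras in \<open>C(K)\<close>\<close>

text \<open>
  Algebra operations and order of \<open>L\<close> are inherited from \<open>C(K)\<close>. Infima are taken inside
  \<open>L\<close> and need not be the pointwise minima. As \<open>L\<close> is a linear subspace, existence of binary
  infima gives binary suprema via \<open>x \<squnion> y = - ((- x) \<sqinter> (- y))\<close>, so \<open>L\<close> is a Riesz space.
\<close>

definition is_inf_in :: "('k::topological_space \<Rightarrow>\<^sub>C real) set \<Rightarrow> ('k \<Rightarrow>\<^sub>C real) \<Rightarrow> ('k \<Rightarrow>\<^sub>C real)
    \<Rightarrow> ('k \<Rightarrow>\<^sub>C real) \<Rightarrow> bool"
  where "is_inf_in L x y m \<longleftrightarrow>
    m \<in> L \<and> m \<le> x \<and> m \<le> y \<and> (\<forall>w\<in>L. w \<le> x \<longrightarrow> w \<le> y \<longrightarrow> w \<le> m)"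

definition f_algebra :: "('k::topological_space \<Rightarrow>\<^sub>C real) set \<Rightarrow> bool"
  where "f_algebra L \<longleftrightarrow>
    subspace L \<and>
    (\<forall>x\<in>L. \<forall>y\<in>L. x * y \<in> L) \<and>
    (\<forall>x\<in>L. \<forall>y\<in>L. \<exists>m. is_inf_in L x y m) \<and>
    (\<forall>x\<in>L. \<forall>y\<in>L. 0 \<le> x \<longrightarrow> 0 \<le> y \<longrightarrow> 0 \<le> x * y) \<and>
    (\<forall>x\<in>L. \<forall>y\<in>L. \<forall>z\<in>L. 0 \<le> z \<longrightarrow> is_inf_in L x y 0 \<longrightarrow>
        is_inf_in L (z * x) y 0 \<and> is_inf_in L (x * z) y 0)"

section \<open>The embedding of \<open>ck(X)\<close> into \<open>C(K)\<close>\<close>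

definition ck :: "'x::real_normed_vector set set"
  where "ck = {A. A \<noteq> {} \<and> compact A \<and> convex A}"

definition hausdorff_dist :: "'x::metric_space set \<Rightarrow> 'x set \<Rightarrow> real"
  where "hausdorff_dist A C = max (SUP a\<in>A. infdist a C) (SUP c\<in>C. infdist c A)"

definition minkowski_comb ::
    "real \<Rightarrow> 'x::real_vector set \<Rightarrow> real \<Rightarrow> 'x set \<Rightarrow> 'x set"
  where "minkowski_comb \<alpha> A \<beta> C = {\<alpha> *\<^sub>R a + \<beta> *\<^sub>R c | a c. a \<in> A \<and> c \<in> C}"

text \<open>Only the values of \<open>j\<close> on \<^const>\<open>ck\<close> matter.\<close>

definition ck_embedding :: "('x::banach set \<Rightarrow> ('k::topological_space \<Rightarrow>\<^sub>C real)) \<Rightarrow> bool"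
  where "ck_embedding j \<longleftrightarrow>
    (\<forall>A\<in>ck. \<forall>C\<in>ck. \<forall>\<alpha>\<ge>0. \<forall>\<beta>\<ge>0.
        j (minkowski_comb \<alpha> A \<beta> C) = \<alpha> *\<^sub>R j A + \<beta> *\<^sub>R j C) \<and>
    (\<forall>A\<in>ck. \<forall>C\<in>ck. hausdorff_dist A C = norm (j A - j C)) \<and>
    closed (j ` ck) \<and>
    (\<forall>A\<in>ck. \<forall>C\<in>ck. \<forall>k. j (convex hull (A \<union> C)) k = max (j A k) (j C k))"

definition ck_r :: "('x::banach set \<Rightarrow> ('k::topological_space \<Rightarrow>\<^sub>C real)) \<Rightarrow> ('k \<Rightarrow>\<^sub>C real) set"
  where "ck_r j = {r *\<^sub>R j A | r A. A \<in> ck}"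

section \<open>Bochner integrability\<close>

text \<open>
  The library notions \<^const>\<open>has_bochner_integral\<close> and \<^const>\<open>integrable\<close> are restricted to
  second countable target spaces, whereas \<open>C(K)\<close> is in general not separable. The definition below is
  the one of the library without this restriction; in a Banach space the integrals of
  the simple functions \<open>s i\<close> then converge automatically.
\<close>

definition bochner_integrable :: "'w measure \<Rightarrow> ('w \<Rightarrow> 'e::real_normed_vector) \<Rightarrow> bool"
  where "bochner_integrable M f \<longleftrightarrow>
    f \<in> borel_measurable M \<and>
    (\<exists>s. (\<forall>i. Bochner_Integration.simple_bochner_integrable M (s i)) \<and>
         (\<lambda>i. \<integral>\<^sup>+ \<omega>. ennreal (norm (f \<omega> - s i \<omega>)) \<partial>M) \<longlonglongrightarrow> 0)"

lemma integrable_imp_bochner_integrable: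
  fixes f :: "'w \<Rightarrow> 'e::{banach, second_countable_topology}"
  assumes "integrable M f"
  shows "bochner_integrable M f"
  using assms
  by (auto simp: bochner_integrable_def integrable.simps has_bochner_integral.simps)

lemma bochner_integrable_imp_integrable:
  fixes f :: "'w \<Rightarrow> 'e::{banach, second_countable_topology}"
  assumes "bochner_integrable M f"
  shows "integrable M f"
proof -
  from assms obtain s where f: "f \<in> borel_measurable M"
    and s: "\<And>i. Bochner_Integration.simple_bochner_integrable M (s i)"
    and lim: "(\<lambda>i. \<integral>\<^sup>+ \<omega>. ennreal (norm (f \<omega> - s i \<omega>)) \<partial>M) \<longlonglongrightarrow> 0"
    by (auto simp: bochner_integrable_def)
  from lim have "eventually (\<lambda>i. (\<integral>\<^sup>+ \<omega>. ennreal (norm (f \<omega> - s i \<omega>)) \<partial>M) < 1) sequentially"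
    by (rule order_tendstoD) simp
  then obtain i where i: "(\<integral>\<^sup>+ \<omega>. ennreal (norm (f \<omega> - s i \<omega>)) \<partial>M) < 1"
    by (auto simp: eventually_sequentially)
  have si: "integrable M (s i)"
    using has_bochner_integral_simple_bochner_integrable[OF s] by (rule integrable.intros)
  have "integrable M (\<lambda>\<omega>. f \<omega> - s i \<omega>)"
    using f si i by (intro integrableI_bounded) (auto intro: less_trans)
  from Bochner_Integration.integrable_add[OF this si] show ?thesis by simp
qed

section \<open>Conditional expectation\<close>

text \<open>
  \<open>is_cond_exp M F W V\<close>: \<open>V\<close> is a version of \<open>\<E>(W | F)\<close> for the sub-\<open>\<sigma>\<close>-algebra \<open>F\<close>, that is,
  \<open>V\<close> is Bochner integrable on \<open>(\<Omega>, F, P)\<close> and \<open>\<E>(f(W) | F) = f(V)\<close> almost surely for every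
  continuous linear functional \<open>f\<close>.
\<close>

definition is_cond_exp ::
    "'w measure \<Rightarrow> 'w measure \<Rightarrow> ('w \<Rightarrow> 'e::real_normed_vector) \<Rightarrow> ('w \<Rightarrow> 'e) \<Rightarrow> bool"
  where "is_cond_exp M F W V \<longleftrightarrow>
    subalgebra M F \<and>
    bochner_integrable (restr_to_subalg M F) V \<and>
    (\<forall>f :: 'e \<Rightarrow> real. bounded_linear f \<longrightarrow>
      (AE \<omega> in M. real_cond_exp M F (\<lambda>\<omega>. f (W \<omega>)) \<omega> = f (V \<omega>)))"

section \<open>Brownian motions\<close>

text \<open>Time runs through \<open>[0, \<infinity>)\<close>; the values of a process at negative times are irrelevant.\<close>

definition natural_filtration ::
    "'w measure \<Rightarrow> (real \<Rightarrow> 'w \<Rightarrow> 'e::topological_space) \<Rightarrow> real \<Rightarrow> 'w measure"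
  where "natural_filtration M B s =
    sigma (space M) {B u -` A \<inter> space M | u A. 0 \<le> u \<and> u \<le> s \<and> A \<in> sets borel}"

text \<open>A standard real Brownian motion relative to the filtration \<open>F\<close>.\<close>

definition std_brownian_motion ::
    "'w measure \<Rightarrow> (real \<Rightarrow> 'w measure) \<Rightarrow> (real \<Rightarrow> 'w \<Rightarrow> real) \<Rightarrow> bool"
  where "std_brownian_motion M F W \<longleftrightarrow>
    (\<forall>t\<ge>0. W t \<in> borel_measurable (F t)) \<and>
    (AE \<omega> in M. W 0 \<omega> = 0) \<and>
    (\<forall>s t. 0 \<le> s \<and> s < t \<longrightarrow>
      distributed M lborel (\<lambda>\<omega>. W t \<omega> - W s \<omega>) (normal_density 0 (sqrt (t - s))) \<and>
      prob_space.indep_set M (sets (F s))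
        (sets (vimage_algebra (space M) (\<lambda>\<omega>. W t \<omega> - W s \<omega>) borel))) \<and>
    (AE \<omega> in M. continuous_on {0..} (\<lambda>t. W t \<omega>))"

text \<open>
  In the last clause the coordinate processes are Brownian motions relative to the natural
  filtration of the whole \<open>C(K)\<close>-valued process \<open>B\<close>. Brownian motion of every coordinate relative to
  its own filtration alone would not make \<open>B\<close> a martingale: for two points \<open>k\<close>, \<open>k'\<close> the
  filtration of \<open>B\<close> could then contain the future of \<open>(B\<^sub>t(k))\<^sub>t\<close> through \<open>(B\<^sub>t(k'))\<^sub>t\<close>, for instance
  if \<open>B\<^sub>t(k') = B\<^sub>1(k) - B\<^sub>1\<^sub>-\<^sub>t(k)\<close> for \<open>t \<le> 1\<close> and \<open>B\<^sub>t(k') = B\<^sub>t(k)\<close> for \<open>t \<ge> 1\<close>.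
\<close>

definition set_valued_brownian_motion ::
    "('x::banach set \<Rightarrow> ('k::topological_space \<Rightarrow>\<^sub>C real)) \<Rightarrow> 'w measure \<Rightarrow> ('k \<Rightarrow>\<^sub>C real) set
      \<Rightarrow> (real \<Rightarrow> 'w \<Rightarrow> ('k \<Rightarrow>\<^sub>C real)) \<Rightarrow> bool"
  where "set_valued_brownian_motion j M L B \<longleftrightarrow>
    (\<forall>t\<ge>0. B t \<in> borel_measurable M) \<and>
    (\<forall>t\<ge>0. \<forall>\<omega>\<in>space M. B t \<omega> \<in> ck_r j) \<and>
    f_algebra L \<and>
    (\<forall>t>0. \<forall>\<omega>\<in>space M. B t \<omega> \<in> L) \<and>
    (\<forall>t>0. bochner_integrable M (B t) \<and> bochner_integrable M (\<lambda>\<omega>. (B t \<omega>)\<^sup>2)) \<and>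
    (\<forall>k. std_brownian_motion M (natural_filtration M B) (\<lambda>t \<omega>. B t \<omega> k))"

end

theory Submission
  imports Defs
begin

text \<open>
  For a single evaluation functional the claim is the classical martingale property of
  \<open>W\<^sub>t\<^sup>2 - t\<close>. Evaluations alone determine the Bochner integrals over the sets of \<open>\<F>\<^sub>s\<close>, and bounded
  functionals commute with those integrals; so the identity extends to all of \<open>C(K)\<^sup>*\<close> without
  representing functionals by measures. The integrals themselves are never formed: only the
  integrals of approximating simple functions occur, so no completeness of \<open>C(K)\<close> is used.
\<close>

section \<open>Bochner integrability in non-separable spaces\<close>

text \<open>Sums of Borel functions into a non-separable space need not be Borel.\<close>

lemma borel_measurable_diff_simple_function:
  fixes f s :: "'w \<Rightarrow> 'e::real_normed_vector"
  assumes f: "f \<in> borel_measurable M" and s: "simple_function M s"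
  shows "(\<lambda>x. f x - s x) \<in> borel_measurable M"
\<comment> \<open>On each of the finitely many fibres of \<open>s\<close> the difference is a
  translate of \<open>f\<close> by a constant, and translations are continuous.\<close>
proof (rule measurable_compose_countable'[where f = "\<lambda>d x. f x - d" and I = "s ` space M"])
  show "(\<lambda>x. f x - d) \<in> borel_measurable M" for d
  proof -
    have "(\<lambda>y. y - d) \<in> borel_measurable borel"
      by (intro borel_measurable_continuous_onI continuous_intros)
    from measurable_compose[OF f this] show ?thesis .
  qed
  show "s \<in> measurable M (count_space (s ` space M))"
    using s by (auto intro!: measurableI simple_functionD(2))
  show "countable (s ` space M)"
    using s by (auto simp: simple_function_def intro: countable_finite)
qed

text \<open>One approximant per error bound replaces the approximating sequence, so that each
  closure property below only has to transform a single simple function.\<close>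

lemma bochner_integrable_iff:
  "bochner_integrable M f \<longleftrightarrow> f \<in> borel_measurable M \<and>
    (\<forall>e>0. \<exists>s. Bochner_Integration.simple_bochner_integrable M s \<and>
      (\<integral>\<^sup>+ \<omega>. ennreal (norm (f \<omega> - s \<omega>)) \<partial>M) \<le> ennreal e)"
proof (intro iffI conjI allI impI)
  assume "bochner_integrable M f"
  then obtain s where f: "f \<in> borel_measurable M"
    and s: "\<And>i. Bochner_Integration.simple_bochner_integrable M (s i)"
    and lim: "(\<lambda>i. \<integral>\<^sup>+ \<omega>. ennreal (norm (f \<omega> - s i \<omega>)) \<partial>M) \<longlonglongrightarrow> 0"
    by (auto simp: bochner_integrable_def)
  show "f \<in> borel_measurable M" by fact
  fix e :: real assume "e > 0"
  then have "eventually (\<lambda>i. (\<integral>\<^sup>+ \<omega>. ennreal (norm (f \<omega> - s i \<omega>)) \<partial>M) < ennreal e) sequentially"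
    using lim by (intro order_tendstoD(2)) auto
  then obtain i where "(\<integral>\<^sup>+ \<omega>. ennreal (norm (f \<omega> - s i \<omega>)) \<partial>M) < ennreal e"
    by (auto simp: eventually_sequentially)
  with s show "\<exists>s. Bochner_Integration.simple_bochner_integrable M s \<and>
      (\<integral>\<^sup>+ \<omega>. ennreal (norm (f \<omega> - s \<omega>)) \<partial>M) \<le> ennreal e"
    by (auto intro: less_imp_le)
next
  assume f: "f \<in> borel_measurable M \<and>
    (\<forall>e>0. \<exists>s. Bochner_Integration.simple_bochner_integrable M s \<and>
      (\<integral>\<^sup>+ \<omega>. ennreal (norm (f \<omega> - s \<omega>)) \<partial>M) \<le> ennreal e)"
  \<comment> \<open>The error bounds \<open>1/(i+1)\<close> recover a sequence of
    approximants.\<close>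
  then have "\<exists>s. Bochner_Integration.simple_bochner_integrable M s \<and>
      (\<integral>\<^sup>+ \<omega>. ennreal (norm (f \<omega> - s \<omega>)) \<partial>M) \<le> ennreal (inverse (real (Suc i)))" for i
    by (simp del: of_nat_Suc)
  then obtain s where s: "\<And>i. Bochner_Integration.simple_bochner_integrable M (s i)"
    and le: "\<And>i. (\<integral>\<^sup>+ \<omega>. ennreal (norm (f \<omega> - s i \<omega>)) \<partial>M) \<le> ennreal (inverse (real (Suc i)))"
    by metis
  have "(\<lambda>i. ennreal (inverse (real (Suc i)))) \<longlonglongrightarrow> 0"
    using tendsto_ennrealI[OF LIMSEQ_inverse_real_of_nat] by (simp only: ennreal_0)
  then have "(\<lambda>i. \<integral>\<^sup>+ \<omega>. ennreal (norm (f \<omega> - s i \<omega>)) \<partial>M) \<longlonglongrightarrow> 0"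
    by (rule tendsto_sandwich[OF _ _ tendsto_const, rotated 2]) (auto simp only: le zero_le eventually_True)
  then have "\<exists>s. (\<forall>i. Bochner_Integration.simple_bochner_integrable M (s i)) \<and>
      (\<lambda>i. \<integral>\<^sup>+ \<omega>. ennreal (norm (f \<omega> - s i \<omega>)) \<partial>M) \<longlonglongrightarrow> 0"
    using s by (intro exI[of _ s]) simp
  then show "bochner_integrable M f"
    using conjunct1[OF f] unfolding bochner_integrable_def by simp
qed

text \<open>Multiplying the approximant by the same indicator does not increase the pointwise error,
  and its support can only shrink. This turns an integral over a set into one over the whole
  space.\<close>

lemma bochner_integrable_indicator:
  assumes f: "bochner_integrable M f" and A: "A \<in> sets M"
  shows "bochner_integrable M (\<lambda>x. indicator A x *\<^sub>R f x)"
  unfolding bochner_integrable_iff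
proof (intro conjI allI impI)
  have "(\<lambda>x. if x \<in> A then f x else 0) \<in> borel_measurable M"
    using f A by (intro measurable_If_set) (auto simp: bochner_integrable_def)
  also have "(\<lambda>x. if x \<in> A then f x else 0) = (\<lambda>x. indicator A x *\<^sub>R f x)"
    by (auto simp: fun_eq_iff)
  finally show "(\<lambda>x. indicator A x *\<^sub>R f x) \<in> borel_measurable M" .
  fix e :: real assume "e > 0"
  with f obtain s where s: "Bochner_Integration.simple_bochner_integrable M s"
    and le: "(\<integral>\<^sup>+ \<omega>. ennreal (norm (f \<omega> - s \<omega>)) \<partial>M) \<le> ennreal e"
    by (auto simp: bochner_integrable_iff)
  have sf: "simple_function M (\<lambda>x. indicator A x *\<^sub>R s x)"
    using s A by (intro simple_function_compose2[where h = "(*\<^sub>R)"])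
      (auto elim: Bochner_Integration.simple_bochner_integrable.cases)
  have "{x \<in> space M. s x \<noteq> 0} \<in> sets M"
  proof -
    have "s -` (- {0}) \<inter> space M \<in> sets M"
      using s by (auto intro: simple_functionD(2) elim: Bochner_Integration.simple_bochner_integrable.cases)
    also have "s -` (- {0}) \<inter> space M = {x \<in> space M. s x \<noteq> 0}" by auto
    finally show ?thesis .
  qed
  then have "emeasure M {x \<in> space M. indicator A x *\<^sub>R s x \<noteq> 0} \<le> emeasure M {x \<in> space M. s x \<noteq> 0}"
    by (intro emeasure_mono) auto
  also have "\<dots> < \<infinity>"
    using s by (auto elim!: Bochner_Integration.simple_bochner_integrable.cases simp: less_top)
  finally have si: "Bochner_Integration.simple_bochner_integrable M (\<lambda>x. indicator A x *\<^sub>R s x)"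
    using sf by (auto intro!: Bochner_Integration.simple_bochner_integrable.intros)
  have "(\<integral>\<^sup>+ \<omega>. ennreal (norm (indicator A \<omega> *\<^sub>R f \<omega> - indicator A \<omega> *\<^sub>R s \<omega>)) \<partial>M)
      \<le> (\<integral>\<^sup>+ \<omega>. ennreal (norm (f \<omega> - s \<omega>)) \<partial>M)"
    by (intro nn_integral_mono ennreal_leI) (auto split: split_indicator)
  with le si show "\<exists>s. Bochner_Integration.simple_bochner_integrable M s \<and>
      (\<integral>\<^sup>+ \<omega>. ennreal (norm (indicator A \<omega> *\<^sub>R f \<omega> - s \<omega>)) \<partial>M) \<le> ennreal e"
    by (meson order_trans)
qed

text \<open>Shifting the approximant by \<open>c\<close> as well leaves the error unchanged. The
  shifted function may be nonzero everywhere, so its support has finite measure because the whole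
  space does.\<close>

lemma (in finite_measure) bochner_integrable_add_const:
  assumes f: "bochner_integrable M f"
  shows "bochner_integrable M (\<lambda>x. f x + c)"
  unfolding bochner_integrable_iff
proof (intro conjI allI impI)
  have "(\<lambda>y. y + c) \<in> borel_measurable borel"
    by (intro borel_measurable_continuous_onI continuous_intros)
  with f show "(\<lambda>x. f x + c) \<in> borel_measurable M"
    by (auto simp: bochner_integrable_def intro: measurable_compose)
  fix e :: real assume "e > 0"
  with f obtain s where s: "Bochner_Integration.simple_bochner_integrable M s"
    and le: "(\<integral>\<^sup>+ \<omega>. ennreal (norm (f \<omega> - s \<omega>)) \<partial>M) \<le> ennreal e"
    by (auto simp: bochner_integrable_iff)
  have "simple_function M (\<lambda>x. s x + c)"
    using s by (intro simple_function_compose1[where g = "\<lambda>y. y + c"])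
      (auto elim: Bochner_Integration.simple_bochner_integrable.cases)
  then have "Bochner_Integration.simple_bochner_integrable M (\<lambda>x. s x + c)"
    by (intro Bochner_Integration.simple_bochner_integrable.intros) auto
  with le show "\<exists>s. Bochner_Integration.simple_bochner_integrable M s \<and>
      (\<integral>\<^sup>+ \<omega>. ennreal (norm (f \<omega> + c - s \<omega>)) \<partial>M) \<le> ennreal e"
    by (intro exI[of _ "\<lambda>x. s x + c"]) simp
qed

section \<open>Passage to a sub-\<sigma>-algebra\<close>

text \<open>
  An \<open>M\<close>-simple approximation \<open>s\<close> of an \<open>F\<close>-measurable \<open>f\<close> is replaced by a function that selects,
  at each point, a value of \<open>s\<close> nearest to \<open>f\<close>. It is \<open>F\<close>-measurable and approximates at least as well.
\<close>

lemma ex_nearest_simple_function: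
  fixes f :: "'w \<Rightarrow> 'e::real_normed_vector"
  assumes f: "f \<in> borel_measurable F" and D: "finite D" "D \<noteq> {}"
  obtains g where "simple_function F g" "\<And>x d. d \<in> D \<Longrightarrow> norm (f x - g x) \<le> norm (f x - d)"
  using D
proof (induction D arbitrary: thesis rule: finite_ne_induct)
  case (singleton d)
  show ?case by (rule singleton[of "\<lambda>_. d"]) auto
next
  case (insert d D)
  obtain g where g: "simple_function F g"
    and le: "\<And>x d. d \<in> D \<Longrightarrow> norm (f x - g x) \<le> norm (f x - d)"
    using insert.IH by blast
  have "(\<lambda>x. norm (f x - g x)) \<in> borel_measurable F" "(\<lambda>x. norm (f x - d)) \<in> borel_measurable F"
    using borel_measurable_diff_simple_function[OF f g]
      borel_measurable_diff_simple_function[OF f simple_function_const[of F d]] by auto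
  \<comment> \<open>The new candidate \<open>d\<close> is taken exactly where it is strictly nearer
    than \<open>g\<close>; this set is measurable because both distances are.\<close>
  then have "simple_function F (\<lambda>x. if norm (f x - g x) \<le> norm (f x - d) then g x else d)"
    using g by (intro simple_function_If) auto
  then show ?case
  proof (rule insert.prems)
    fix x d'
    assume "d' \<in> insert d D"
    then show "norm (f x - (if norm (f x - g x) \<le> norm (f x - d) then g x else d)) \<le> norm (f x - d')"
      using le[of d' x] by auto
  qed
qed

text \<open>A conditional expectation must have approximants that are simple for the smaller
  \<sigma>-algebra; integrability over \<open>M\<close> only supplies simple functions for
  \<open>M\<close>.\<close>

lemma bochner_integrable_restr_to_subalg:
  assumes "finite_measure M" and sub: "subalgebra M F"
    and f: "bochner_integrable M f" and fF: "f \<in> borel_measurable F"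
  shows "bochner_integrable (restr_to_subalg M F) f"
  unfolding bochner_integrable_iff
proof (intro conjI allI impI)
  let ?R = "restr_to_subalg M F"
  interpret R: finite_measure ?R
    using sub assms(1) by (rule finite_measure_restr_to_subalg)
  show fR: "f \<in> borel_measurable ?R"
    using sub fF by (rule measurable_in_subalg)
  fix e :: real assume "e > 0"
  with f obtain s where s: "Bochner_Integration.simple_bochner_integrable M s"
    and le: "(\<integral>\<^sup>+ \<omega>. ennreal (norm (f \<omega> - s \<omega>)) \<partial>M) \<le> ennreal e"
    by (auto simp: bochner_integrable_iff)
  \<comment> \<open>Inserting \<open>0\<close> keeps the set of candidates nonempty even if
    \<open>space M\<close> is empty.\<close>
  have "finite (insert 0 (s ` space M))"
    using s by (auto simp: simple_function_def elim: Bochner_Integration.simple_bochner_integrable.cases)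
  then obtain g where g: "simple_function ?R g"
    and near: "\<And>x d. d \<in> insert 0 (s ` space M) \<Longrightarrow> norm (f x - g x) \<le> norm (f x - d)"
    using ex_nearest_simple_function[OF fR, of "insert 0 (s ` space M)"] by blast
  have "(\<lambda>x. ennreal (norm (f x - g x))) \<in> borel_measurable F"
    using borel_measurable_diff_simple_function[OF fR g] sub by (auto dest: measurable_in_subalg')
  then have "(\<integral>\<^sup>+ \<omega>. ennreal (norm (f \<omega> - g \<omega>)) \<partial>?R) = (\<integral>\<^sup>+ \<omega>. ennreal (norm (f \<omega> - g \<omega>)) \<partial>M)"
    using sub by (rule nn_integral_subalgebra2[rotated])
  \<comment> \<open>At each point the value of \<open>s\<close> is itself one of the
    candidates.\<close>
  also have "\<dots> \<le> (\<integral>\<^sup>+ \<omega>. ennreal (norm (f \<omega> - s \<omega>)) \<partial>M)"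
    using near by (intro nn_integral_mono ennreal_leI) auto
  also note le
  finally have "(\<integral>\<^sup>+ \<omega>. ennreal (norm (f \<omega> - g \<omega>)) \<partial>?R) \<le> ennreal e" .
  moreover have "Bochner_Integration.simple_bochner_integrable ?R g"
    using g by (intro Bochner_Integration.simple_bochner_integrable.intros) auto
  ultimately show "\<exists>s. Bochner_Integration.simple_bochner_integrable ?R s \<and>
      (\<integral>\<^sup>+ \<omega>. ennreal (norm (f \<omega> - s \<omega>)) \<partial>?R) \<le> ennreal e"
    by blast
qed

section \<open>Bounded functionals and simple integrals\<close>

text \<open>A linear functional commutes exactly with the integral of a simple function, and
  \<open>f\<close> enlarges the error by at most the factor \<open>C\<close>. Hence the simple
  integral of \<open>s\<close> can stand in for an integral of \<open>W\<close>.\<close>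

lemma simple_bochner_integral_approx:
  fixes f :: "'e::real_normed_vector \<Rightarrow> real"
  assumes f: "bounded_linear f" and C: "0 \<le> C" "\<And>x. \<bar>f x\<bar> \<le> C * norm x"
    and W: "W \<in> borel_measurable M"
    and s: "Bochner_Integration.simple_bochner_integrable M s"
    and e: "0 \<le> e" "(\<integral>\<^sup>+ \<omega>. ennreal (norm (W \<omega> - s \<omega>)) \<partial>M) \<le> ennreal e"
  shows "integrable M (\<lambda>\<omega>. f (W \<omega>))"
    and "\<bar>(\<integral>\<omega>. f (W \<omega>) \<partial>M) - f (Bochner_Integration.simple_bochner_integral M s)\<bar> \<le> C * e"
proof -
  interpret f: bounded_linear f by fact
  have sf: "simple_function M s"
    using s by (rule Bochner_Integration.simple_bochner_integrable.cases)
  have [measurable]: "(\<lambda>\<omega>. f (W \<omega>)) \<in> borel_measurable M"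
    using W by (rule measurable_compose)
      (intro borel_measurable_continuous_onI f.continuous_on continuous_on_id)
  \<comment> \<open>The composition rule takes two simple functions; both are \<open>s\<close>, and
    the second argument is ignored.\<close>
  have fs: "Bochner_Integration.simple_bochner_integrable M (\<lambda>\<omega>. f (s \<omega>))"
    using simple_bochner_integrable_compose2[of "\<lambda>x y. f x", OF _ s s] by (simp add: f.zero)
  have fs_int: "has_bochner_integral M (\<lambda>\<omega>. f (s \<omega>)) (f (Bochner_Integration.simple_bochner_integral M s))"
    using has_bochner_integral_simple_bochner_integrable[OF fs]
      simple_bochner_integral_linear[OF f.linear s] by simp
  then have [measurable]: "(\<lambda>\<omega>. f (s \<omega>)) \<in> borel_measurable M"
    by (auto dest: borel_measurable_has_bochner_integral)
  have "(\<integral>\<^sup>+ \<omega>. ennreal (norm (f (W \<omega>) - f (s \<omega>))) \<partial>M)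
      \<le> (\<integral>\<^sup>+ \<omega>. ennreal C * ennreal (norm (W \<omega> - s \<omega>)) \<partial>M)"
    using C by (intro nn_integral_mono) (auto simp flip: f.diff ennreal_mult intro!: ennreal_leI)
  also have "\<dots> = ennreal C * (\<integral>\<^sup>+ \<omega>. ennreal (norm (W \<omega> - s \<omega>)) \<partial>M)"
    using borel_measurable_diff_simple_function[OF W sf] by (intro nn_integral_cmult) auto
  also have "\<dots> \<le> ennreal C * ennreal e"
    using e by (intro mult_left_mono) auto
  also have "\<dots> = ennreal (C * e)"
    using C e by (simp add: ennreal_mult)
  finally have le: "(\<integral>\<^sup>+ \<omega>. ennreal (norm (f (W \<omega>) - f (s \<omega>))) \<partial>M) \<le> ennreal (C * e)" .
  then have diff: "integrable M (\<lambda>\<omega>. f (W \<omega>) - f (s \<omega>))"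
    by (intro integrableI_bounded) (auto simp: less_top[symmetric] top_unique)
  from Bochner_Integration.integrable_add[OF this integrable.intros[OF fs_int]]
  show int: "integrable M (\<lambda>\<omega>. f (W \<omega>))" by simp
  have "ennreal (norm (\<integral>\<omega>. f (W \<omega>) - f (s \<omega>) \<partial>M)) \<le> (\<integral>\<^sup>+ \<omega>. ennreal (norm (f (W \<omega>) - f (s \<omega>))) \<partial>M)"
    using diff by (rule integral_norm_bound_ennreal)
  also note le
  finally have "norm (\<integral>\<omega>. f (W \<omega>) - f (s \<omega>) \<partial>M) \<le> C * e"
    using C e by (simp add: ennreal_le_iff)
  also have "(\<integral>\<omega>. f (W \<omega>) - f (s \<omega>) \<partial>M)
      = (\<integral>\<omega>. f (W \<omega>) \<partial>M) - f (Bochner_Integration.simple_bochner_integral M s)"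
    using int fs_int by (subst Bochner_Integration.integral_diff)
      (auto dest: has_bochner_integral_integral_eq intro: integrable.intros)
  finally show "\<bar>(\<integral>\<omega>. f (W \<omega>) \<partial>M) - f (Bochner_Integration.simple_bochner_integral M s)\<bar> \<le> C * e"
    by simp
qed

text \<open>A single approximant with finite error suffices, hence the arbitrary error bound
  \<open>1\<close>.\<close>

lemma bochner_integrable_bounded_linear:
  fixes f :: "'e::real_normed_vector \<Rightarrow> real"
  assumes "bochner_integrable M W" "bounded_linear f"
  shows "integrable M (\<lambda>\<omega>. f (W \<omega>))"
proof -
  obtain s where "W \<in> borel_measurable M"
    "Bochner_Integration.simple_bochner_integrable M s"
    "(\<integral>\<^sup>+ \<omega>. ennreal (norm (W \<omega> - s \<omega>)) \<partial>M) \<le> ennreal 1"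
    using assms(1) by (auto simp: bochner_integrable_iff dest: spec[of _ 1])
  moreover obtain C where "0 \<le> C" "\<And>x. \<bar>f x\<bar> \<le> C * norm x"
    using bounded_linear.nonneg_bounded[OF assms(2)] by (auto simp: mult.commute)
  ultimately show ?thesis
    using simple_bochner_integral_approx(1)[OF assms(2), of C W M s 1] by simp
qed

section \<open>Evaluations determine integrals in \<open>C(K)\<close>\<close>

lemma abs_apply_bcontfun_le: "\<bar>apply_bcontfun g k\<bar> \<le> norm g" for g :: "'k::topological_space \<Rightarrow>\<^sub>C real"
  using norm_bounded[of g k] by simp

lemma bounded_linear_apply_bcontfun:
  "bounded_linear (\<lambda>g :: 'k::topological_space \<Rightarrow>\<^sub>C real. apply_bcontfun g k)"
  by (rule bounded_linear_intro[of _ 1]) (auto simp: abs_apply_bcontfun_le)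

text \<open>The integrals of simple approximants of \<open>W\<close> and \<open>V\<close> are
  elements of \<open>C(K)\<close> whose values nearly agree at every \<open>k\<close>, uniformly in
  \<open>k\<close>. So they are close in the supremum norm, and a bounded \<open>f\<close> nearly
  agrees on them.\<close>

lemma bochner_integral_bcontfun_eqI:
  fixes W V :: "'w \<Rightarrow> ('k::topological_space \<Rightarrow>\<^sub>C real)"
  assumes W: "bochner_integrable M W" and V: "bochner_integrable M V"
    and eq: "\<And>k. (\<integral>\<omega>. W \<omega> k \<partial>M) = (\<integral>\<omega>. V \<omega> k \<partial>M)"
    and f: "bounded_linear f"
  shows "(\<integral>\<omega>. f (W \<omega>) \<partial>M) = (\<integral>\<omega>. f (V \<omega>) \<partial>M :: real)"
proof -
  interpret f: bounded_linear f by fact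
  obtain C where C: "0 \<le> C" "\<And>x. \<bar>f x\<bar> \<le> C * norm x"
    using f.nonneg_bounded by (auto simp: mult.commute)
  \<comment> \<open>The factor 4 is the sum of 1 for replacing \<open>W\<close> by \<open>s\<close>,
    1 for replacing \<open>V\<close> by \<open>r\<close>, and 2 for the distance between the two
    simple integrals.\<close>
  have le: "\<bar>(\<integral>\<omega>. f (W \<omega>) \<partial>M) - (\<integral>\<omega>. f (V \<omega>) \<partial>M)\<bar> \<le> 4 * C * e" if "e > 0" for e
  proof -
    obtain s where s: "Bochner_Integration.simple_bochner_integrable M s"
      "(\<integral>\<^sup>+ \<omega>. ennreal (norm (W \<omega> - s \<omega>)) \<partial>M) \<le> ennreal e"
      using W \<open>e > 0\<close> by (auto simp: bochner_integrable_iff)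
    obtain r where r: "Bochner_Integration.simple_bochner_integrable M r"
      "(\<integral>\<^sup>+ \<omega>. ennreal (norm (V \<omega> - r \<omega>)) \<partial>M) \<le> ennreal e"
      using V \<open>e > 0\<close> by (auto simp: bochner_integrable_iff)
    let ?I = "Bochner_Integration.simple_bochner_integral M s"
    let ?J = "Bochner_Integration.simple_bochner_integral M r"
    have meas: "W \<in> borel_measurable M" "V \<in> borel_measurable M"
      using W V by (auto simp: bochner_integrable_def)
    have "norm (?I - ?J) \<le> 2 * e"
    proof (rule norm_bound)
      fix k
      \<comment> \<open>Every evaluation satisfies the bound with constant \<open>1\<close>, so the
        error does not depend on \<open>k\<close>.\<close>
      have "\<bar>(\<integral>\<omega>. W \<omega> k \<partial>M) - ?I k\<bar> \<le> 1 * e" "\<bar>(\<integral>\<omega>. V \<omega> k \<partial>M) - ?J k\<bar> \<le> 1 * e"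
        using simple_bochner_integral_approx(2)[OF bounded_linear_apply_bcontfun[of k], of 1 _ M _ e]
          s r meas \<open>e > 0\<close> by (simp_all add: abs_apply_bcontfun_le)
      with eq[of k] show "norm ((?I - ?J) k) \<le> 2 * e" by simp
    qed
    then have "C * norm (?I - ?J) \<le> C * (2 * e)"
      using C by (intro mult_left_mono) auto
    then have "\<bar>f ?I - f ?J\<bar> \<le> C * (2 * e)"
      using C(2)[of "?I - ?J"] by (simp add: f.diff)
    moreover have "\<bar>(\<integral>\<omega>. f (W \<omega>) \<partial>M) - f ?I\<bar> \<le> C * e" "\<bar>(\<integral>\<omega>. f (V \<omega>) \<partial>M) - f ?J\<bar> \<le> C * e"
      using s r meas \<open>e > 0\<close> C f by (auto intro!: simple_bochner_integral_approx(2))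
    ultimately show ?thesis by linarith
  qed
  have "\<bar>(\<integral>\<omega>. f (W \<omega>) \<partial>M) - (\<integral>\<omega>. f (V \<omega>) \<partial>M)\<bar> \<le> 0 + e" if "e > 0" for e
  proof -
    \<comment> \<open>Dividing by \<open>4 * C + 1\<close> instead of \<open>4 * C\<close> covers
      the case \<open>C = 0\<close>.\<close>
    have "4 * C * (e / (4 * C + 1)) \<le> e"
      using C \<open>e > 0\<close> by (simp add: field_simps)
    with le[of "e / (4 * C + 1)"] show ?thesis
      using C \<open>e > 0\<close> by (simp add: add_nonneg_pos)
  qed
  then have "\<bar>(\<integral>\<omega>. f (W \<omega>) \<partial>M) - (\<integral>\<omega>. f (V \<omega>) \<partial>M)\<bar> \<le> 0"
    by (rule field_le_epsilon)
  then show ?thesis by simp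
qed

text \<open>The defining property of a conditional expectation concerns integrals over the sets of
  \<open>F\<close>. For each such set, agreement at all evaluations extends to every bounded
  functional by the preceding lemma.\<close>

lemma is_cond_exp_bcontfunI:
  fixes W V :: "'w \<Rightarrow> ('k::topological_space \<Rightarrow>\<^sub>C real)"
  assumes "finite_measure M" and sub: "subalgebra M F"
    and W: "bochner_integrable M W" and V: "bochner_integrable M V"
    and VF: "V \<in> borel_measurable F"
    and eq: "\<And>k A. A \<in> sets F \<Longrightarrow>
      (\<integral>\<omega>. indicator A \<omega> * W \<omega> k \<partial>M) = (\<integral>\<omega>. indicator A \<omega> * V \<omega> k \<partial>M)"
  shows "is_cond_exp M F W V"
  unfolding is_cond_exp_def
proof (intro conjI allI impI)
  interpret finite_measure_subalgebra M F
    using assms(1) sub by (simp add: finite_measure_subalgebra_def finite_measure_subalgebra_axioms_def)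
  show "subalgebra M F" by fact
  show "bochner_integrable (restr_to_subalg M F) V"
    using assms(1) sub V VF by (rule bochner_integrable_restr_to_subalg)
  fix f :: "('k \<Rightarrow>\<^sub>C real) \<Rightarrow> real" assume f: "bounded_linear f"
  interpret f: bounded_linear f by fact
  show "AE \<omega> in M. real_cond_exp M F (\<lambda>\<omega>. f (W \<omega>)) \<omega> = f (V \<omega>)"
  proof (rule real_cond_exp_charact)
    fix A assume A: "A \<in> sets F"
    then have "A \<in> sets M" using sub by (auto simp: subalgebra_def)
    \<comment> \<open>The indicator is kept inside \<open>f\<close>, so that the truncated functions
      are the two Bochner integrable functions being compared; linearity moves it outside
      afterwards.\<close>
    then have "(\<integral>\<omega>. f (indicator A \<omega> *\<^sub>R W \<omega>) \<partial>M) = (\<integral>\<omega>. f (indicator A \<omega> *\<^sub>R V \<omega>) \<partial>M)"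
      using eq[OF A] by (intro bochner_integral_bcontfun_eqI[OF bochner_integrable_indicator[OF W]
          bochner_integrable_indicator[OF V] _ f]) simp_all
    then show "(\<integral>\<omega>\<in>A. f (W \<omega>) \<partial>M) = (\<integral>\<omega>\<in>A. f (V \<omega>) \<partial>M)"
      by (simp add: set_lebesgue_integral_def f.scaleR)
  next
    show "(\<lambda>\<omega>. f (V \<omega>)) \<in> borel_measurable F"
      using VF by (rule measurable_compose)
        (intro borel_measurable_continuous_onI f.continuous_on continuous_on_id)
  qed (rule bochner_integrable_bounded_linear[OF W f] bochner_integrable_bounded_linear[OF V f])+
qed

section \<open>Squares of processes with independent increments\<close>

text \<open>The \<sigma>-algebras generated by \<open>X\<close> and \<open>Y\<close> lie inside
  \<open>F\<close> and \<open>G\<close>, and independence passes to smaller families of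
  events.\<close>

lemma (in prob_space) indep_set_expectation_mult:
  fixes X Y :: "'a \<Rightarrow> real"
  assumes ind: "indep_set (sets F) (sets G)" and sp: "space F = space M" "space G = space M"
    and X: "X \<in> borel_measurable F" "integrable M X"
    and Y: "Y \<in> borel_measurable G" "integrable M Y"
  shows "integrable M (\<lambda>\<omega>. X \<omega> * Y \<omega>)"
    and "expectation (\<lambda>\<omega>. X \<omega> * Y \<omega>) = expectation X * expectation Y"
proof -
  have "sigma_sets (space M) {X -` A \<inter> space M | A. A \<in> sets borel} \<subseteq> sets F"
    using measurable_sets[OF X(1)] unfolding sp(1)[symmetric]
    by (intro sets.sigma_sets_subset) auto
  moreover have "sigma_sets (space M) {Y -` A \<inter> space M | A. A \<in> sets borel} \<subseteq> sets G"
    using measurable_sets[OF Y(1)] unfolding sp(2)[symmetric]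
    by (intro sets.sigma_sets_subset) auto
  ultimately have "indep_set (sigma_sets (space M) {X -` A \<inter> space M | A. A \<in> sets borel})
      (sigma_sets (space M) {Y -` A \<inter> space M | A. A \<in> sets borel})"
    using ind unfolding indep_sets2_eq by blast
  then have "indep_var borel X borel Y"
    unfolding indep_var_eq using X Y by auto
  from this X(2) Y(2) show "integrable M (\<lambda>\<omega>. X \<omega> * Y \<omega>)"
    "expectation (\<lambda>\<omega>. X \<omega> * Y \<omega>) = expectation X * expectation Y"
    by (rule indep_var_integrable indep_var_lebesgue_integral)+
qed

lemma (in prob_space) normal_distributed_second_moment:
  assumes \<sigma>: "0 < \<sigma>" and D: "distributed M lborel X (normal_density 0 \<sigma>)"
  shows "integrable M X" and "integrable M (\<lambda>\<omega>. (X \<omega>)\<^sup>2)"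
    and "expectation X = 0" and "expectation (\<lambda>\<omega>. (X \<omega>)\<^sup>2) = \<sigma>\<^sup>2"
proof -
  show "expectation X = 0" using normal_distributed_expectation[OF \<sigma> D] .
  with normal_distributed_variance[OF \<sigma> D] show "expectation (\<lambda>\<omega>. (X \<omega>)\<^sup>2) = \<sigma>\<^sup>2" by simp
  show "integrable M X"
    using integrable_normal_moment[OF \<sigma>, of 0 1] distributed_integrable[OF D, of "\<lambda>x. x"] by simp
  show "integrable M (\<lambda>\<omega>. (X \<omega>)\<^sup>2)"
    using integrable_normal_moment[OF \<sigma>, of 0 2] distributed_integrable[OF D, of "\<lambda>x. x\<^sup>2"] by simp
qed

text \<open>With \<open>Z = Y - X\<close>, expand the square of \<open>X + Z\<close>. On
  \<open>A\<close> the cross term integrates to zero, because \<open>Z\<close> is centred and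
  independent of \<open>F\<close>, and the square of \<open>Z\<close> contributes its variance times
  the probability of \<open>A\<close>.\<close>

lemma (in prob_space) integral_square_indep_increment:
  fixes X Y :: "'a \<Rightarrow> real"
  assumes sub: "subalgebra M F" and A: "A \<in> sets F"
    and X: "X \<in> borel_measurable F" "integrable M X" "integrable M (\<lambda>\<omega>. (X \<omega>)\<^sup>2)"
    and \<sigma>: "0 < \<sigma>"
    and D: "distributed M lborel (\<lambda>\<omega>. Y \<omega> - X \<omega>) (normal_density 0 \<sigma>)"
    and ind: "indep_set (sets F) (sets (vimage_algebra (space M) (\<lambda>\<omega>. Y \<omega> - X \<omega>) borel))"
  shows "(\<integral>\<omega>. indicator A \<omega> * (Y \<omega>)\<^sup>2 \<partial>M) = (\<integral>\<omega>. indicator A \<omega> * ((X \<omega>)\<^sup>2 + \<sigma>\<^sup>2) \<partial>M)"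
proof -
  define Z where "Z = (\<lambda>\<omega>. Y \<omega> - X \<omega>)"
  define G where "G = vimage_algebra (space M) Z borel"
  have Z: "integrable M Z" "integrable M (\<lambda>\<omega>. (Z \<omega>)\<^sup>2)" "expectation Z = 0"
      "expectation (\<lambda>\<omega>. (Z \<omega>)\<^sup>2) = \<sigma>\<^sup>2"
    unfolding Z_def by (rule normal_distributed_second_moment[OF \<sigma> D])+
  have ind': "indep_set (sets F) (sets G)"
    using ind by (simp add: G_def Z_def)
  have sp: "space F = space M" "space G = space M"
    using sub by (auto simp: subalgebra_def G_def)
  have ZG [measurable]: "Z \<in> borel_measurable G"
    unfolding G_def by (rule measurable_vimage_algebra1) auto
  have AM: "A \<in> sets M" using A sub by (auto simp: subalgebra_def)
  note [measurable] = A X(1)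
  have iX: "integrable M (\<lambda>\<omega>. indicator A \<omega> * X \<omega>)"
    "integrable M (\<lambda>\<omega>. indicator A \<omega> * (X \<omega>)\<^sup>2)"
    using integrable_mult_indicator[OF AM X(2)] integrable_mult_indicator[OF AM X(3)] by simp_all
  have iA: "integrable M (indicator A :: 'a \<Rightarrow> real)"
    using AM by (intro integrable_real_indicator) (auto simp: emeasure_eq_measure)
  \<comment> \<open>The factors are grouped so that \<open>indicator A * X\<close> is
    \<open>F\<close>-measurable while \<open>Z\<close> is \<open>G\<close>-measurable.\<close>
  have XZ: "integrable M (\<lambda>\<omega>. (indicator A \<omega> * X \<omega>) * Z \<omega>)"
      "expectation (\<lambda>\<omega>. (indicator A \<omega> * X \<omega>) * Z \<omega>) = 0"
    using indep_set_expectation_mult[OF ind' sp _ iX(1) ZG Z(1)] Z(3) by auto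
  have ZZ: "integrable M (\<lambda>\<omega>. indicator A \<omega> * (Z \<omega>)\<^sup>2)"
      "expectation (\<lambda>\<omega>. indicator A \<omega> * (Z \<omega>)\<^sup>2) = expectation (indicator A) * \<sigma>\<^sup>2"
    using indep_set_expectation_mult[OF ind' sp _ iA _ Z(2)] Z(4) by auto
  have "(\<integral>\<omega>. indicator A \<omega> * (Y \<omega>)\<^sup>2 \<partial>M) = (\<integral>\<omega>. indicator A \<omega> * (X \<omega>)\<^sup>2
      + (2 * ((indicator A \<omega> * X \<omega>) * Z \<omega>) + indicator A \<omega> * (Z \<omega>)\<^sup>2) \<partial>M)"
    by (intro Bochner_Integration.integral_cong) (auto simp: Z_def power2_eq_square algebra_simps)
  also have "\<dots> = (\<integral>\<omega>. indicator A \<omega> * (X \<omega>)\<^sup>2 \<partial>M) + expectation (indicator A) * \<sigma>\<^sup>2"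
    using iX XZ ZZ by simp
  also have "\<dots> = (\<integral>\<omega>. indicator A \<omega> * (X \<omega>)\<^sup>2 + indicator A \<omega> * \<sigma>\<^sup>2 \<partial>M)"
    using iX iA by simp
  finally show ?thesis by (simp add: distrib_left)
qed

section \<open>Natural filtrations\<close>

lemma space_natural_filtration [simp]: "space (natural_filtration M B s) = space M"
  unfolding natural_filtration_def by (rule space_measure_of) auto

lemma sets_natural_filtration:
  "sets (natural_filtration M B s) =
    sigma_sets (space M) {B u -` A \<inter> space M | u A. 0 \<le> u \<and> u \<le> s \<and> A \<in> sets borel}"
  unfolding natural_filtration_def by (rule sets_measure_of) auto

lemma subalgebra_natural_filtration:
  assumes "\<And>u. 0 \<le> u \<Longrightarrow> B u \<in> borel_measurable M"
  shows "subalgebra M (natural_filtration M B s)"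
  unfolding subalgebra_def sets_natural_filtration
  using assms by (auto intro!: sets.sigma_sets_subset intro: measurable_sets)

text \<open>The preimages under \<open>B s\<close> are among the generators, with
  \<open>u = s\<close>.\<close>

lemma measurable_natural_filtration:
  assumes "0 \<le> s"
  shows "B s \<in> borel_measurable (natural_filtration M B s)"
  using assms by (intro measurableI) (auto simp: sets_natural_filtration)

theorem theorem3p9:
  fixes j :: "'x::banach set \<Rightarrow> ('k::t2_space \<Rightarrow>\<^sub>C real)"
    and M :: "'w measure"
    and L :: "('k \<Rightarrow>\<^sub>C real) set"
    and B :: "real \<Rightarrow> 'w \<Rightarrow> ('k \<Rightarrow>\<^sub>C real)"
    and s t :: real
  assumes "compact (UNIV :: 'k set)"
    and "ck_embedding j"
    and "prob_space M"
    and "set_valued_brownian_motion j M L B"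
    and "0 < s" and "s < t"
  shows "is_cond_exp M (natural_filtration M B s)
           (\<lambda>\<omega>. (B t \<omega>)\<^sup>2) (\<lambda>\<omega>. (B s \<omega>)\<^sup>2 + (t - s) *\<^sub>R 1)"
proof -
  interpret prob_space M by fact
  let ?F = "natural_filtration M B s"
  have meas: "\<And>u. 0 \<le> u \<Longrightarrow> B u \<in> borel_measurable M"
    and int: "\<And>u. 0 < u \<Longrightarrow> bochner_integrable M (B u)"
    and int2: "\<And>u. 0 < u \<Longrightarrow> bochner_integrable M (\<lambda>\<omega>. (B u \<omega>)\<^sup>2)"
    and bm: "\<And>k. std_brownian_motion M (natural_filtration M B) (\<lambda>t \<omega>. B t \<omega> k)"
    using assms(4) by (auto simp: set_valued_brownian_motion_def)
  have sub: "subalgebra M ?F"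
    using meas by (rule subalgebra_natural_filtration)
  have V: "bochner_integrable M (\<lambda>\<omega>. (B s \<omega>)\<^sup>2 + (t - s) *\<^sub>R 1)"
    using int2[OF \<open>0 < s\<close>] by (rule bochner_integrable_add_const)
  \<comment> \<open>The candidate is a continuous function of \<open>B s\<close> alone. This avoids
    products and sums of Borel functions into \<open>C(K)\<close>, which need not be Borel.\<close>
  have "(\<lambda>x :: 'k \<Rightarrow>\<^sub>C real. x\<^sup>2 + (t - s) *\<^sub>R 1) \<in> borel_measurable borel"
    unfolding power2_eq_square by (intro borel_measurable_continuous_onI continuous_intros)
  then have VF: "(\<lambda>\<omega>. (B s \<omega>)\<^sup>2 + (t - s) *\<^sub>R 1) \<in> borel_measurable ?F"
    using \<open>0 < s\<close> by (intro measurable_compose[OF measurable_natural_filtration]) simp_all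
  have W: "bochner_integrable M (\<lambda>\<omega>. (B t \<omega>)\<^sup>2)"
    using int2 \<open>0 < s\<close> \<open>s < t\<close> by simp
  show ?thesis
  proof (rule is_cond_exp_bcontfunI[OF finite_measure_axioms sub W V VF])
    fix k A assume A: "A \<in> sets ?F"
    \<comment> \<open>For fixed \<open>k\<close> this is a statement about two real variables,
      \<open>B s\<close> and \<open>B t\<close> at \<open>k\<close>, whose increment has standard
      deviation \<open>sqrt (t - s)\<close>. The increment is independent of the filtration of the
      whole process, so \<open>A\<close> may depend on other points of \<open>K\<close>.\<close>
    have "(\<integral>\<omega>. indicator A \<omega> * (B t \<omega> k)\<^sup>2 \<partial>M)
        = (\<integral>\<omega>. indicator A \<omega> * ((B s \<omega> k)\<^sup>2 + (sqrt (t - s))\<^sup>2) \<partial>M)"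
    proof (rule integral_square_indep_increment[OF sub A])
      show "integrable M (\<lambda>\<omega>. B s \<omega> k)"
        using int[OF \<open>0 < s\<close>] bounded_linear_apply_bcontfun by (rule bochner_integrable_bounded_linear)
      show "integrable M (\<lambda>\<omega>. (B s \<omega> k)\<^sup>2)"
        using bochner_integrable_bounded_linear[OF int2[OF \<open>0 < s\<close>] bounded_linear_apply_bcontfun[of k]]
        by (simp add: power2_eq_square)
    qed (use bm[of k] \<open>0 < s\<close> \<open>s < t\<close> in \<open>auto simp: std_brownian_motion_def\<close>)
    \<comment> \<open>Evaluation at \<open>k\<close> is multiplicative and sends the unit function
      to 1.\<close>
    then show "(\<integral>\<omega>. indicator A \<omega> * ((B t \<omega>)\<^sup>2) k \<partial>M)
        = (\<integral>\<omega>. indicator A \<omega> * ((B s \<omega>)\<^sup>2 + (t - s) *\<^sub>R 1) k \<partial>M)"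
      using \<open>s < t\<close> by (simp add: power2_eq_square)
  qed
qed

end
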